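(* Let $J_T=\{(j,t): j\in J,\ t\in T(j)\}$. For every $J_T'\subseteq J_T$, the inequality $$\sum_{(j,t)\in J_T^1\cup J_T^2}u_{jt}\le \tilde k$$ is valid for the formulation (SL-MCFLP), i.e. it is satisfied by every feasible solution $(x,y,u)$, where: - $\delta_{(1)}\le\delta_{(2)}\le\dots\le\delta_{(|J_T'|)}$ are the costs $c_{jt}$, $(j,t)\in J_T'$, sorted in non-decreasing order (with repetitions); - $\tilde k$ is the largest index $k\in\{0,1,\dots,|J_T'|\}$ such that $\sum_{h=1}^{k}\delta_{(h)}\le B$; - $\tilde c=\max\left\{B-\sum_{h=1}^{\tilde k}\delta_{(h)},\ \delta_{(\tilde k)}\right\}$ (with the convention $\delta_{(0)}=0$); - $J_T^1=\{(j,t)\in J_T:\ \exists\, t'\le t \text{ with } (j,t')\in J_T'\}$; - $J_T^2=\{(j,t)\in J_T\setminus J_T^1:\ c_{jt}>\tilde c\}$.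
   Context: Data. $I$ (clients), $J$ (potential second-level facilities), $M$ (products), $S$ (first-level facilities) are finite sets. Each $s\in S$ offers one product $m(s)\in M$. $M_I(i)\subseteq M$ is the set of products demanded by client $i$. $d_{sj}$ and $d_{ji}$ are distances between $s\in S$ and $j\in J$, and between $j\in J$ and $i\in I$; $R_m, r_m$ are covering radii for each $m\in M$. For $j\in J$, $b_j$ is a nonnegative integer (maximum number of different products $j$ can offer), and $T(j)=\{0,1,\dots,b_j\}$. $w_{is}$ is the (real) satisfaction of client $i$ when served product $m(s)$ from $s$; $c_{jt}\ge 0$ is the cost of offering $t\in T(j)$ different products at $j$, with $c_{jt}\le c_{j,t+1}$ whenever $t,t+1\in T(j)$; $B\ge 0$ is the budget. Derived sets. - $J(i,s)=\{j\in J: d_{ji}\le r_{m(s)},\ d_{sj}\le R_{m(s)}\}$. - $S_M(m)=\{s\in S: m(s)=m\}$. - $M_J(j)=\{m\in M:\exists s\in S \text{ with } m(s)=m,\ d_{sj}\le R_m\}$. - $S_I(i)=\{s\in S: m(s)\in M_I(i),\ J(i,s)\ne\emptyset\}$. Formulation (SL-MCFLP). Variables $y_{is}$ ($i\in I, s\in S_I(i)$), $x_{jm}$ ($j\in J, m\in M_J(j)$), $u_{jt}$ ($j\in J,t\in T(j)$): $$\max \sum_{i\in I}\sum_{s\in S_I(i)} w_{is}y_{is}$$ subject to - $\sum_{j\in J(i,s)}x_{jm(s)}\ge y_{is}$ for $i\in I, s\in S_I(i)$; - $\sum_{s\in S_I(i)\cap S_M(m)}y_{is}\le 1$ for $i\in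 I, m\in M_I(i)$; - $\sum_{m\in M_J(j)}x_{jm}=\sum_{t\in T(j)}t\,u_{jt}$ for $j\in J$; - $\sum_{t\in T(j)}u_{jt}=1$ for $j\in J$; - $\sum_{j\in J}\sum_{t\in T(j)}c_{jt}u_{jt}\le B$; - $y_{is}\in\{0,1\}$, $x_{jm}\in\{0,1\}$, $u_{jt}\in\{0,1\}$ for all indices. *)

theory Defs
  imports Complex_Main "HOL-Library.Multiset"
begin

text \<open>
  Instance data of (SL-MCFLP): \<open>suppliers\<close> are the first-level facilities \<open>S\<close>, \<open>facs\<close> the
  potential second-level facilities \<open>J\<close>, and \<open>cap D j\<close> is the bound \<open>b\<^sub>j\<close>.
\<close>

record ('i, 'j, 'm, 's) mcflp =
  clients :: "'i set"
  facs :: "'j set"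
  products :: "'m set"
  suppliers :: "'s set"
  prod_of :: "'s \<Rightarrow> 'm"
  demand :: "'i \<Rightarrow> 'm set"
  dist_sj :: "'s \<Rightarrow> 'j \<Rightarrow> real"
  dist_ji :: "'j \<Rightarrow> 'i \<Rightarrow> real"
  rad1 :: "'m \<Rightarrow> real"  \<comment> \<open>\<open>R\<^sub>m\<close>, for first-level to second-level distances\<close>
  rad2 :: "'m \<Rightarrow> real"  \<comment> \<open>\<open>r\<^sub>m\<close>, for second-level to client distances\<close>
  cap :: "'j \<Rightarrow> nat"
  weight :: "'i \<Rightarrow> 's \<Rightarrow> real"
  cost :: "'j \<Rightarrow> nat \<Rightarrow> real"
  budget :: real

definition T_set :: "('i, 'j, 'm, 's) mcflp \<Rightarrow> 'j \<Rightarrow> nat set" where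
  "T_set D j = {0..cap D j}"

definition mcflp_data :: "('i, 'j, 'm, 's) mcflp \<Rightarrow> bool" where
  "mcflp_data D \<longleftrightarrow>
     finite (clients D) \<and> finite (facs D) \<and> finite (products D) \<and> finite (suppliers D) \<and>
     (\<forall>s\<in>suppliers D. prod_of D s \<in> products D) \<and>
     (\<forall>i\<in>clients D. demand D i \<subseteq> products D) \<and>
     (\<forall>s\<in>suppliers D. \<forall>j\<in>facs D. 0 \<le> dist_sj D s j) \<and>
     (\<forall>j\<in>facs D. \<forall>i\<in>clients D. 0 \<le> dist_ji D j i) \<and>
     (\<forall>j\<in>facs D. \<forall>t\<in>T_set D j. 0 \<le> cost D j t) \<and>
     (\<forall>j\<in>facs D. \<forall>t. t \<in> T_set D j \<and> t + 1 \<in> T_set D j \<longrightarrow> cost D j t \<le> cost D j (t + 1)) \<and>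
     0 \<le> budget D"

definition J_is :: "('i, 'j, 'm, 's) mcflp \<Rightarrow> 'i \<Rightarrow> 's \<Rightarrow> 'j set" where
  "J_is D i s =
     {j \<in> facs D. dist_ji D j i \<le> rad2 D (prod_of D s) \<and> dist_sj D s j \<le> rad1 D (prod_of D s)}"

definition S_M :: "('i, 'j, 'm, 's) mcflp \<Rightarrow> 'm \<Rightarrow> 's set" where
  "S_M D m = {s \<in> suppliers D. prod_of D s = m}"

definition M_J :: "('i, 'j, 'm, 's) mcflp \<Rightarrow> 'j \<Rightarrow> 'm set" where
  "M_J D j = {m \<in> products D. \<exists>s\<in>suppliers D. prod_of D s = m \<and> dist_sj D s j \<le> rad1 D m}"

definition S_I :: "('i, 'j, 'm, 's) mcflp \<Rightarrow> 'i \<Rightarrow> 's set" where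
  "S_I D i = {s \<in> suppliers D. prod_of D s \<in> demand D i \<and> J_is D i s \<noteq> {}}"

text \<open>
  The variables are total functions; only their values at the index sets of the formulation
  occur in the constraints.  The objective plays no role in the validity of an inequality and
  is recorded only to complete the formulation.
\<close>

definition objective :: "('i, 'j, 'm, 's) mcflp \<Rightarrow> ('i \<Rightarrow> 's \<Rightarrow> real) \<Rightarrow> real" where
  "objective D y = (\<Sum>i\<in>clients D. \<Sum>s\<in>S_I D i. weight D i s * y i s)"

definition feasible ::
  "('i, 'j, 'm, 's) mcflp \<Rightarrow> ('j \<Rightarrow> 'm \<Rightarrow> real) \<Rightarrow> ('i \<Rightarrow> 's \<Rightarrow> real) \<Rightarrow> ('j \<Rightarrow> nat \<Rightarrow> real) \<Rightarrow> bool"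
where
  "feasible D x y u \<longleftrightarrow>
     (\<forall>i\<in>clients D. \<forall>s\<in>S_I D i. (\<Sum>j\<in>J_is D i s. x j (prod_of D s)) \<ge> y i s) \<and>
     (\<forall>i\<in>clients D. \<forall>m\<in>demand D i. (\<Sum>s\<in>S_I D i \<inter> S_M D m. y i s) \<le> 1) \<and>
     (\<forall>j\<in>facs D. (\<Sum>m\<in>M_J D j. x j m) = (\<Sum>t\<in>T_set D j. real t * u j t)) \<and>
     (\<forall>j\<in>facs D. (\<Sum>t\<in>T_set D j. u j t) = 1) \<and>
     (\<Sum>j\<in>facs D. \<Sum>t\<in>T_set D j. cost D j t * u j t) \<le> budget D \<and>
     (\<forall>i\<in>clients D. \<forall>s\<in>S_I D i. y i s \<in> {0, 1}) \<and>
     (\<forall>j\<in>facs D. \<forall>m\<in>M_J D j. x j m \<in> {0, 1}) \<and>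
     (\<forall>j\<in>facs D. \<forall>t\<in>T_set D j. u j t \<in> {0, 1})"

definition JT :: "('i, 'j, 'm, 's) mcflp \<Rightarrow> ('j \<times> nat) set" where
  "JT D = (SIGMA j:facs D. T_set D j)"

definition sorted_costs :: "('i, 'j, 'm, 's) mcflp \<Rightarrow> ('j \<times> nat) set \<Rightarrow> real list" where
  "sorted_costs D A = sorted_list_of_multiset (image_mset (\<lambda>(j, t). cost D j t) (mset_set A))"

text \<open>
  The indices \<open>h\<close> are 1-based, with the convention that the value at \<open>0\<close> is \<open>0\<close>; the list is
  0-based.  Values for \<open>h\<close> above the cardinality of \<open>A\<close> are meaningless and never used.
\<close>

definition delta :: "('i, 'j, 'm, 's) mcflp \<Rightarrow> ('j \<times> nat) set \<Rightarrow> nat \<Rightarrow> real" where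
  "delta D A h = (if h = 0 then 0 else sorted_costs D A ! (h - 1))"

text \<open>
  For admissible data the budget is nonnegative, so \<open>0\<close> belongs to the set below and the
  maximum is well defined.
\<close>

definition k_tilde :: "('i, 'j, 'm, 's) mcflp \<Rightarrow> ('j \<times> nat) set \<Rightarrow> nat" where
  "k_tilde D A = Max {k \<in> {0..card A}. (\<Sum>h=1..k. delta D A h) \<le> budget D}"

definition c_tilde :: "('i, 'j, 'm, 's) mcflp \<Rightarrow> ('j \<times> nat) set \<Rightarrow> real" where
  "c_tilde D A =
     max (budget D - (\<Sum>h=1..k_tilde D A. delta D A h)) (delta D A (k_tilde D A))"

definition JT1 :: "('i, 'j, 'm, 's) mcflp \<Rightarrow> ('j \<times> nat) set \<Rightarrow> ('j \<times> nat) set" where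
  "JT1 D A = {(j, t) \<in> JT D. \<exists>t'\<le>t. (j, t') \<in> A}"

definition JT2 :: "('i, 'j, 'm, 's) mcflp \<Rightarrow> ('j \<times> nat) set \<Rightarrow> ('j \<times> nat) set" where
  "JT2 D A = {(j, t) \<in> JT D - JT1 D A. cost D j t > c_tilde D A}"

end

theory Submission
  imports Defs
begin

text \<open>
  The pairs with \<open>u j t = 1\<close> lie over distinct facilities. Those among them in \<open>JT1\<close>, say \<open>p\<close> many,
  can be lowered injectively to pairs of \<open>JT'\<close> without raising the cost, so they cost at least the
  \<open>p\<close> cheapest pairs of \<open>JT'\<close>, and hence \<open>p \<le> k_tilde\<close>. Each of the \<open>q\<close> pairs in \<open>JT2\<close> costs more
  than \<open>c_tilde\<close>. If \<open>p + q > k_tilde\<close>, then \<open>k_tilde - p\<close> of the latter replace the terms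
  \<open>delta (p + 1), \<dots>, delta k_tilde\<close>, and one more exceeds the remaining budget, so that the
  total cost exceeds the budget.
\<close>

text \<open>Induction on \<open>xs\<close>: the head is charged to one element of \<open>N\<close>
  that is at least as large, and the rest of \<open>N\<close> still fits into the tail.\<close>

lemma sum_take_sorted_le_sum_mset:
  fixes xs :: "real list"
  assumes "sorted xs" "N \<subseteq># mset xs"
  shows "sum_list (take (size N) xs) \<le> \<Sum>\<^sub># N"
  using assms
proof (induction xs arbitrary: N)
  case Nil
  then show ?case by simp
next
  case (Cons a xs)
  show ?case
  proof (cases "N = {#}")
    case False
    \<comment> \<open>If \<open>a\<close> occurs in \<open>N\<close>, it is charged to itself.
      Otherwise \<open>N\<close> already lies in the tail, whose elements are all at least
      \<open>a\<close>, and any \<open>b\<close> will do.\<close>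
    obtain b where b: "b \<in># N" "a \<le> b" "N - {#b#} \<subseteq># mset xs"
    proof (cases "a \<in># N")
      case True
      then show ?thesis
        using that[of a] Cons.prems(2) by (simp add: subset_eq_diff_conv)
    next
      case a: False
      obtain b where "b \<in># N" using False by auto
      moreover have "N \<subseteq># mset xs"
        using Cons.prems(2) a
        by (metis diff_single_trivial mset.simps(2) subset_eq_diff_conv add_mset_add_single)
      moreover from calculation have "a \<le> b"
        using Cons.prems(1) by (auto dest: mset_subset_eqD)
      ultimately show ?thesis
        using that[of b] by (meson diff_subset_eq_self subset_mset.order_trans)
    qed
    then obtain N' where N': "N = add_mset b N'" by (metis multi_member_split)
    have "sum_list (take (size N') xs) \<le> \<Sum>\<^sub># N'"
      using Cons.IH[of N'] Cons.prems(1) b(3) N' by simp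
    then show ?thesis using b(2) N' by simp
  qed simp
qed

lemma length_sorted_costs: "length (sorted_costs D A) = card A"
  unfolding sorted_costs_def
  by (metis mset_sorted_list_of_multiset size_image_mset size_mset size_mset_set)

text \<open>Bridges 1-based indices and the 0-based list; the bound on \<open>k\<close> keeps every
  index inside the list.\<close>

lemma sum_delta_eq_sum_take:
  assumes "k \<le> card A"
  shows "(\<Sum>h=1..k. delta D A h) = sum_list (take k (sorted_costs D A))"
proof -
  have "(\<Sum>h=1..k. delta D A h) = (\<Sum>h=0..<k. delta D A (Suc h))"
    using sum.shift_bounds_Suc_ivl[of "delta D A" 0 k] by (simp add: atLeastLessThanSuc_atLeastAtMost)
  also have "\<dots> = (\<Sum>h=0..<k. sorted_costs D A ! h)"
    by (simp add: delta_def)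
  finally show ?thesis
    using assms by (simp add: sum_list_sum_nth length_sorted_costs min_def)
qed

text \<open>Passing to multisets counts equal costs of different pairs separately.\<close>

lemma sum_delta_le_sum_cost:
  assumes "finite A" "Q \<subseteq> A"
  shows "(\<Sum>h=1..card Q. delta D A h) \<le> (\<Sum>(j, t)\<in>Q. cost D j t)"
proof -
  let ?N = "image_mset (\<lambda>(j, t). cost D j t) (mset_set Q)"
  have "?N \<subseteq># mset (sorted_costs D A)"
    using assms by (simp add: sorted_costs_def image_mset_subseteq_mono subset_imp_msubset_mset_set)
  moreover have "sorted (sorted_costs D A)"
    by (simp add: sorted_costs_def)
  ultimately have "sum_list (take (size ?N) (sorted_costs D A)) \<le> \<Sum>\<^sub># ?N"
    by (intro sum_take_sorted_le_sum_mset)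
  moreover have "card Q \<le> card A"
    using assms by (simp add: card_mono)
  ultimately show ?thesis
    unfolding sum_delta_eq_sum_take[OF \<open>card Q \<le> card A\<close>] by (simp add: sum_unfold_sum_mset)
qed

text \<open>\<open>1 \<le> h\<close> excludes the default value 0, which need not lie below the
  costs, as their sign is not restricted here.\<close>

lemma delta_mono:
  assumes "1 \<le> h" "h \<le> k" "k \<le> card A"
  shows "delta D A h \<le> delta D A k"
proof -
  have "sorted (sorted_costs D A)"
    by (simp add: sorted_costs_def)
  then show ?thesis
    using assms by (auto simp: delta_def length_sorted_costs intro!: sorted_nth_mono)
qed

lemma finite_JT: "mcflp_data D \<Longrightarrow> finite (JT D)"
  by (auto simp: JT_def T_set_def mcflp_data_def)

lemma k_tilde_properties:
  assumes "mcflp_data D"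
  shows "k_tilde D A \<le> card A" "(\<Sum>h=1..k_tilde D A. delta D A h) \<le> budget D"
proof -
  let ?K = "{k \<in> {0..card A}. (\<Sum>h=1..k. delta D A h) \<le> budget D}"
  have "0 \<in> ?K" using assms by (simp add: mcflp_data_def)
  then have "Max ?K \<in> ?K" by (intro Max_in) auto
  then show "k_tilde D A \<le> card A" "(\<Sum>h=1..k_tilde D A. delta D A h) \<le> budget D"
    by (simp_all add: k_tilde_def)
qed

lemma k_tilde_maximal:
  assumes "k \<le> card A" "(\<Sum>h=1..k. delta D A h) \<le> budget D"
  shows "k \<le> k_tilde D A"
  unfolding k_tilde_def using assms by (intro Max_ge) auto

lemma cost_mono:
  assumes "mcflp_data D" "j \<in> facs D" "t' \<le> t" "t \<le> cap D j"
  shows "cost D j t' \<le> cost D j t"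
  using assms(3,4)
proof (induction t rule: dec_induct)
  case (step n)
  have "cost D j n \<le> cost D j (n + 1)"
    using assms(1,2) step.prems by (auto simp: mcflp_data_def T_set_def)
  then show ?case using step by simp
qed simp

text \<open>The two conclusions are what \<open>k_tilde_maximal\<close> requires once the cost of
  \<open>P\<close> is within the budget.\<close>

lemma JT1_selection_cost:
  assumes "mcflp_data D" "finite A" "P \<subseteq> JT1 D A" "inj_on fst P"
  shows "card P \<le> card A" "(\<Sum>h=1..card P. delta D A h) \<le> (\<Sum>(j, t)\<in>P. cost D j t)"
proof -
  have "\<forall>z\<in>P. \<exists>t'\<le>snd z. (fst z, t') \<in> A"
    using assms(3) by (auto simp: JT1_def)
  then obtain f where f: "\<And>z. z \<in> P \<Longrightarrow> f z \<le> snd z \<and> (fst z, f z) \<in> A"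
    by metis
  define g where "g z = (fst z, f z)" for z
  \<comment> \<open>Lowering keeps the facility, so distinct facilities suffice, whichever levels
    \<open>f\<close> picks.\<close>
  have inj: "inj_on g P"
    using assms(4) by (auto simp: inj_on_def g_def)
  have gA: "g ` P \<subseteq> A"
    using f by (auto simp: g_def)
  have card: "card (g ` P) = card P"
    using inj by (rule card_image)
  show "card P \<le> card A"
    using card_mono[OF assms(2) gA] card by simp
  have "(\<Sum>h=1..card P. delta D A h) \<le> (\<Sum>(j, t)\<in>g ` P. cost D j t)"
    using sum_delta_le_sum_cost[OF assms(2) gA, of D] card by simp
  also have "\<dots> = (\<Sum>z\<in>P. cost D (fst z) (f z))"
    by (simp add: sum.reindex[OF inj]) (simp add: g_def)
  also have "\<dots> \<le> (\<Sum>z\<in>P. cost D (fst z) (snd z))"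
  proof (rule sum_mono)
    fix z assume z: "z \<in> P"
    then have "z \<in> JT1 D A" using assms(3) by blast
    then have "fst z \<in> facs D" "snd z \<le> cap D (fst z)"
      by (auto simp: JT1_def JT_def T_set_def)
    moreover have "f z \<le> snd z" using f[OF z] ..
    ultimately show "cost D (fst z) (f z) \<le> cost D (fst z) (snd z)"
      by (intro cost_mono[OF assms(1)])
  qed
  finally show "(\<Sum>h=1..card P. delta D A h) \<le> (\<Sum>(j, t)\<in>P. cost D j t)"
    by (simp add: case_prod_beta)
qed

text \<open>The combinatorial core: a feasible solution enters only as a selection with one level
  per facility and total cost within the budget.\<close>

lemma selection_card_le_k_tilde:
  assumes D: "mcflp_data D" and A: "A \<subseteq> JT D"
    and P: "P \<subseteq> JT1 D A \<union> JT2 D A" and inj: "inj_on fst P"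
    and B: "(\<Sum>(j, t)\<in>P. cost D j t) \<le> budget D"
  shows "card P \<le> k_tilde D A"
proof (rule ccontr)
  assume "\<not> card P \<le> k_tilde D A"
  let ?k = "k_tilde D A" and ?d = "delta D A" and ?c = "\<lambda>(j, t). cost D j t"
  let ?P1 = "P \<inter> JT1 D A" and ?P2 = "P - JT1 D A"
  have PJT: "P \<subseteq> JT D" using P by (auto simp: JT1_def JT2_def)
  have finP: "finite P" and finA: "finite A"
    using PJT A finite_JT[OF D] finite_subset by blast+
  have split: "sum ?c P = sum ?c ?P1 + sum ?c ?P2"
    using sum.Int_Diff[OF finP] by blast
  have cards: "card P = card ?P1 + card ?P2"
    using finP by (metis card_Int_Diff)
  have P1: "card ?P1 \<le> card A" "(\<Sum>h=1..card ?P1. ?d h) \<le> sum ?c ?P1"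
    by (rule JT1_selection_cost[OF D finA _ inj_on_subset[OF inj]]; rule Int_lower1 Int_lower2)+
  have nonneg: "0 \<le> sum ?c ?P2"
    using PJT D by (intro sum_nonneg) (auto simp: JT_def mcflp_data_def)
  have p_le: "card ?P1 \<le> ?k"
    using P1 B split nonneg by (intro k_tilde_maximal) auto
  have q: "?k - card ?P1 + 1 \<le> card ?P2"
    using \<open>\<not> card P \<le> ?k\<close> cards p_le by linarith
  have c_ge: "budget D - (\<Sum>h=1..?k. ?d h) \<le> c_tilde D A" "?d ?k \<le> c_tilde D A"
    by (simp_all add: c_tilde_def)
  \<comment> \<open>Lets the multiplier of \<open>c_tilde D A\<close> grow from
    \<open>?k - card ?P1 + 1\<close> to \<open>card ?P2\<close> below.\<close>
  have c_nonneg: "0 \<le> c_tilde D A"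
    using c_ge(1) k_tilde_properties(2)[OF D, of A] by linarith
  have "(\<Sum>h=1..?k. ?d h) = (\<Sum>h=1..card ?P1. ?d h) + (\<Sum>h=card ?P1 + 1..?k. ?d h)"
    using sum.ub_add_nat[of 1 "card ?P1" ?d "?k - card ?P1"] p_le by simp
  moreover have "(\<Sum>h=card ?P1 + 1..?k. ?d h) \<le> (\<Sum>h=card ?P1 + 1..?k. c_tilde D A)"
    by (intro sum_mono order_trans[OF delta_mono c_ge(2)])
      (use k_tilde_properties(1)[OF D] in auto)
  \<comment> \<open>One copy of \<open>c_tilde D A\<close> covers the leftover budget, the others
    the terms after \<open>card ?P1\<close>.\<close>
  ultimately have "budget D \<le> (\<Sum>h=1..card ?P1. ?d h) + real (?k - card ?P1 + 1) * c_tilde D A"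
    using c_ge(1) by (simp add: algebra_simps)
  also have "\<dots> \<le> sum ?c ?P1 + (\<Sum>z\<in>?P2. c_tilde D A)"
    unfolding sum_constant using q by (intro add_mono P1(2) mult_right_mono c_nonneg) simp
  also have "(\<Sum>z\<in>?P2. c_tilde D A) < sum ?c ?P2"
  proof (rule sum_strict_mono)
    have "0 < card ?P2" using q by linarith
    then show "?P2 \<noteq> {}" by (rule card_gt_0_iff[THEN iffD1, THEN conjunct1])
  qed (use finP P in \<open>auto simp: JT2_def\<close>)
  finally show False using B split by simp
qed

text \<open>Two levels with value 1 at one facility would push the sum of the nonnegative
  \<open>u j t\<close> to at least 2.\<close>

lemma inj_on_fst_selection:
  assumes "feasible D x y u"
  shows "inj_on fst {(j, t) \<in> JT D. u j t = 1}"
proof -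
  have False if "j \<in> facs D" "t \<in> T_set D j" "t' \<in> T_set D j" "u j t = 1" "u j t' = 1" "t \<noteq> t'"
    for j t t'
  proof -
    have u: "sum (u j) (T_set D j) = 1" "\<forall>s\<in>T_set D j. u j s \<in> {0, 1}"
      using assms \<open>j \<in> facs D\<close> by (auto simp only: feasible_def)
    have "sum (u j) {t, t'} \<le> sum (u j) (T_set D j)"
    proof (rule sum_mono2)
      show "finite (T_set D j)" by (simp add: T_set_def)
      show "{t, t'} \<subseteq> T_set D j" using that by simp
      show "0 \<le> u j s" if "s \<in> T_set D j - {t, t'}" for s
        using u(2) that by fastforce
    qed
    then show False using u(1) that by simp
  qed
  then show ?thesis by (fastforce simp: inj_on_def JT_def)
qed

theorem proposition3p3:
  fixes D :: "('i, 'j, 'm, 's) mcflp"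
    and JT' :: "('j \<times> nat) set"
    and x :: "'j \<Rightarrow> 'm \<Rightarrow> real"
    and y :: "'i \<Rightarrow> 's \<Rightarrow> real"
    and u :: "'j \<Rightarrow> nat \<Rightarrow> real"
  assumes "mcflp_data D"
    and "JT' \<subseteq> JT D"
    and "feasible D x y u"
  shows "(\<Sum>(j, t)\<in>JT1 D JT' \<union> JT2 D JT'. u j t) \<le> real (k_tilde D JT')"
proof -
  let ?U = "JT1 D JT' \<union> JT2 D JT'"
  let ?P = "{(j, t) \<in> ?U. u j t = 1}"
  have UJT: "?U \<subseteq> JT D" by (auto simp: JT1_def JT2_def)
  have fin: "finite (JT D)" by (rule finite_JT[OF assms(1)])
  have finU: "finite ?U" using UJT fin by (rule finite_subset)
  have u01: "u j t = 0 \<or> u j t = 1" if "(j, t) \<in> JT D" for j t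
    using assms(3) that by (auto simp: feasible_def JT_def)
  have cost_nonneg: "0 \<le> cost D j t" if "(j, t) \<in> JT D" for j t
    using assms(1) that by (auto simp: mcflp_data_def JT_def)
  have "(\<Sum>(j, t)\<in>?U. u j t) = (\<Sum>(j, t)\<in>?P. u j t)"
    by (rule sum.mono_neutral_right[OF finU]) (use UJT u01 in auto)
  also have "\<dots> = (\<Sum>z\<in>?P. 1)"
    by (rule sum.cong) auto
  finally have sum_u: "(\<Sum>(j, t)\<in>?U. u j t) = real (card ?P)" by simp
  \<comment> \<open>The factor is 1 on \<open>?P\<close>; with it the sum extends to all of
    \<open>JT D\<close>, where the budget constraint applies.\<close>
  have "(\<Sum>(j, t)\<in>?P. cost D j t) = (\<Sum>(j, t)\<in>?P. cost D j t * u j t)"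
    by (rule sum.cong) auto
  also have "\<dots> \<le> (\<Sum>(j, t)\<in>JT D. cost D j t * u j t)"
  proof (rule sum_mono2[OF fin])
    show "?P \<subseteq> JT D" using UJT by auto
    show "0 \<le> (case z of (j, t) \<Rightarrow> cost D j t * u j t)" if "z \<in> JT D - ?P" for z
      using that u01 cost_nonneg by (cases z) force
  qed
  also have "\<dots> = (\<Sum>j\<in>facs D. \<Sum>t\<in>T_set D j. cost D j t * u j t)"
    unfolding JT_def by (rule sum.Sigma[symmetric])
      (use assms(1) in \<open>auto simp: mcflp_data_def T_set_def\<close>)
  also have "\<dots> \<le> budget D"
    using assms(3) by (simp add: feasible_def)
  finally have cost: "(\<Sum>(j, t)\<in>?P. cost D j t) \<le> budget D" .
  have "inj_on fst ?P"
    by (rule inj_on_subset[OF inj_on_fst_selection[OF assms(3)]]) (use UJT in auto)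
  then have "card ?P \<le> k_tilde D JT'"
    using cost by (intro selection_card_le_k_tilde[OF assms(1,2)]) auto
  then show ?thesis using sum_u by simp
qed

end
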